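(* Let $d \geq 1$, let $\mathcal{X} \subset \mathbb{R}^d$ be a compact convex set with non-empty interior, let $\kappa > 0$, and let $f : \mathcal{X} \to \mathbb{R}$ be a $\kappa$-Lipschitz function. Let $t \geq 1$ and let $(X_i)_{1 \leq i \leq t}$ be the previous potential maximizers of LIPO (run on $f$ with constant $\kappa$) at time $t$. For $x \in \mathcal{X}$, let $R(x,t+1)$ be the event that LIPO rejects the candidate $x$ at time $t+1$, i.e. the event $$ \min_{1 \leq i \leq t} \big( f(X_i) + \kappa \lVert x - X_i \rVert_2 \big) < \max_{1 \leq i \leq t} f(X_i). $$ Then, when the candidate $x$ is sampled uniformly at random in $\mathcal{X}$, $$ \mathbb{P}(R(x,t+1)) \leq \frac{t\, \pi^{d/2} \Delta^d}{\kappa^d\, \Gamma(d/2+1)\, \lambda(\mathcal{X})}, $$ where $\Delta = \max_{x \in \mathcal{X}} f(x) - \min_{x \in \mathcal{X}} f(x)$ is the diameter of the image $f(\mathcal{X})$, $\lambda$ is the Lebesgue measure on $\mathbb{R}^d$, and $\Gamma(s) = \int_0^\infty u^{s-1} e^{-u}\,\mathrm{d}u$ is the Gamma function.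
   Context: A function $f : \mathcal{X} \to \mathbb{R}$ is $\kappa$-Lipschitz if $|f(x) - f(x')| \leq \kappa \lVert x - x' \rVert_2$ for all $x, x' \in \mathcal{X}$. LIPO is a sequential stochastic algorithm for maximizing a $\kappa$-Lipschitz function $f$ with known constant $\kappa$ over $\mathcal{X}$. It produces a sequence of points $X_1, X_2, \dots \in \mathcal{X}$, called potential maximizers, at which $f$ is evaluated. The first sampled candidate is accepted as $X_1$. Given the potential maximizers $X_1, \dots, X_t$ found so far, LIPO samples candidates $x$ uniformly at random in $\mathcal{X}$ (i.e. from the measure $\lambda(\cdot \cap \mathcal{X})/\lambda(\mathcal{X})$, independently of the past). A candidate $x$ is accepted as a potential maximizer (and becomes $X_{t+1}$) if and only if $$ \max_{1 \leq i \leq t} f(X_i) \leq \min_{1 \leq i \leq t} \big( f(X_i) + \kappa \lVert x - X_i \rVert_2 \big), $$ and is rejected otherwise. "Time $t$" refers to the number $t$ of potential maximizers found so far, not to the number of sampled candidates. The probability $\mathbb{P}(R(x,t+1))$ is the probability, over the uniform draw of the candidate $x$ in $\mathcal{X}$, that $x$ is rejected, the potential maximizers $X_1, \dots, X_t$ being given. *)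

theory Defs
  imports "HOL-Probability.Probability"
begin

text \<open>
  The list \<open>Xs\<close> holds the potential maximizers found so far, oldest first; these
  predicates are only meaningful for nonempty \<open>Xs\<close>.
\<close>

definition lipo_accepts :: "('a::euclidean_space \<Rightarrow> real) \<Rightarrow> real \<Rightarrow> 'a list \<Rightarrow> 'a \<Rightarrow> bool" where
  "lipo_accepts f \<kappa> Xs x \<longleftrightarrow>
     (MAX z\<in>set Xs. f z) \<le> (MIN z\<in>set Xs. f z + \<kappa> * norm (x - z))"

definition lipo_rejects :: "('a::euclidean_space \<Rightarrow> real) \<Rightarrow> real \<Rightarrow> 'a list \<Rightarrow> 'a \<Rightarrow> bool" where
  "lipo_rejects f \<kappa> Xs x \<longleftrightarrow>
     (MIN z\<in>set Xs. f z + \<kappa> * norm (x - z)) < (MAX z\<in>set Xs. f z)"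

definition lipo_step :: "('a::euclidean_space \<Rightarrow> real) \<Rightarrow> real \<Rightarrow> 'a list \<Rightarrow> 'a \<Rightarrow> 'a list" where
  "lipo_step f \<kappa> Xs x = (if Xs = [] \<or> lipo_accepts f \<kappa> Xs x then Xs @ [x] else Xs)"

text \<open>
  The potential maximizers of a LIPO run whose sampled candidates, in order of sampling,
  are \<open>cs\<close>. The time of the run is the length of the result, not the length of \<open>cs\<close>.
\<close>

definition lipo :: "('a::euclidean_space \<Rightarrow> real) \<Rightarrow> real \<Rightarrow> 'a list \<Rightarrow> 'a list" where
  "lipo f \<kappa> cs = foldl (lipo_step f \<kappa>) [] cs"

text \<open>
  The maximum minus the minimum of \<open>f\<close> over \<open>S\<close>; meaningful only when both are attained,
  as for continuous \<open>f\<close> on nonempty compact \<open>S\<close>.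
\<close>

definition image_range :: "('a \<Rightarrow> real) \<Rightarrow> 'a set \<Rightarrow> real" where
  "image_range f S = (GREATEST y. y \<in> f ` S) - (LEAST y. y \<in> f ` S)"

end

theory Submission
  imports Defs
begin

text \<open>
  A candidate \<open>x\<close> is rejected only if some earlier point \<open>z\<close> has
  \<open>f z + \<kappa> * norm (x - z) < max f\<close>, where \<open>max f\<close> runs over the earlier points. All
  earlier points lie in the domain, so this forces \<open>\<kappa> * norm (x - z) < \<Delta>\<close>, where \<open>\<Delta>\<close>
  is the range of \<open>f\<close>. The rejection region is therefore covered by
  one ball of radius \<open>\<Delta> / \<kappa>\<close> for each of the \<open>t\<close> earlier points
  (\<open>lipo_rejects_subset_balls\<close>). A union bound over these balls, with the formula for the
  volume of a Euclidean ball, gives the estimate.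
\<close>

lemma set_lipo_subset: "set (lipo f \<kappa> cs) \<subseteq> set cs"
proof -
  have "set (foldl (lipo_step f \<kappa>) Ys cs) \<subseteq> set Ys \<union> set cs" for Ys
    by (induction cs arbitrary: Ys) (fastforce simp: lipo_step_def split: if_splits)+
  from this[of "[]"] show ?thesis
    by (simp add: lipo_def)
qed

text \<open>
  On a compact set a continuous function attains its extrema, so that the two choice
  operators in the definition of the range denote them.
\<close>

lemma diff_le_image_range:
  fixes f :: "'a::topological_space \<Rightarrow> real"
  assumes "compact S" "continuous_on S f" "x \<in> S" "y \<in> S"
  shows "f x - f y \<le> image_range f S"
proof -
  have "S \<noteq> {}"
    using assms(3) by blast
  obtain a where a: "a \<in> S" "\<And>z. z \<in> S \<Longrightarrow> f z \<le> f a"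
    using continuous_attains_sup[OF assms(1) \<open>S \<noteq> {}\<close> assms(2)] by blast
  obtain b where b: "b \<in> S" "\<And>z. z \<in> S \<Longrightarrow> f b \<le> f z"
    using continuous_attains_inf[OF assms(1) \<open>S \<noteq> {}\<close> assms(2)] by blast
  have "(GREATEST y. y \<in> f ` S) = f a"
    using a by (intro Greatest_equality) auto
  moreover have "(LEAST y. y \<in> f ` S) = f b"
    using b by (intro Least_equality) auto
  ultimately show ?thesis
    using a(2)[OF assms(3)] b(2)[OF assms(4)] by (simp add: image_range_def)
qed

lemma lipo_rejects_iff:
  assumes "Xs \<noteq> []"
  shows "lipo_rejects f \<kappa> Xs x \<longleftrightarrow>
    (\<exists>z\<in>set Xs. \<exists>w\<in>set Xs. f z + \<kappa> * norm (x - z) < f w)"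
  using assms by (auto simp: lipo_rejects_def Min_less_iff Max_gr_iff)

text \<open>
  The rejection inequality is strict, so open balls suffice. This also covers the case
  \<open>\<Delta> = 0\<close>, where the balls are empty and no candidate can be rejected.
\<close>

lemma lipo_rejects_subset_balls:
  assumes "\<kappa> > 0" "Xs \<noteq> []"
    and range: "\<And>z w. z \<in> set Xs \<Longrightarrow> w \<in> set Xs \<Longrightarrow> f w - f z \<le> \<Delta>"
  shows "{x. lipo_rejects f \<kappa> Xs x} \<subseteq> (\<Union>z\<in>set Xs. ball z (\<Delta> / \<kappa>))"
proof
  fix x assume "x \<in> {x. lipo_rejects f \<kappa> Xs x}"
  then obtain z w where zw: "z \<in> set Xs" "w \<in> set Xs" "f z + \<kappa> * norm (x - z) < f w"
    using lipo_rejects_iff[OF assms(2)] by blast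
  then have "\<kappa> * norm (x - z) < \<Delta>"
    using range[OF zw(1,2)] by linarith
  then have "x \<in> ball z (\<Delta> / \<kappa>)"
    using assms(1) by (simp add: dist_norm norm_minus_commute field_simps)
  then show "x \<in> (\<Union>z\<in>set Xs. ball z (\<Delta> / \<kappa>))"
    using zw(1) by blast
qed

lemma measure_UN_balls_le:
  fixes A :: "'a::euclidean_space set"
  assumes "finite A" "r \<ge> 0"
  shows "measure lborel (\<Union>z\<in>A. ball z r)
    \<le> real (card A) * (unit_ball_vol DIM('a) * r ^ DIM('a))"
proof -
  have "measure lborel (\<Union>z\<in>A. ball z r) \<le> (\<Sum>z\<in>A. measure lborel (ball z r))"
    by (intro measure_UNION_le assms) auto
  also have "\<dots> = real (card A) * (unit_ball_vol DIM('a) * r ^ DIM('a))"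
    using assms(2) by (simp add: content_ball)
  finally show ?thesis .
qed

lemma measure_uniform_measure_le:
  assumes "A \<in> sets M" "B \<in> sets M" "C \<in> fmeasurable M"
    and "emeasure M A \<noteq> 0" "emeasure M A \<noteq> \<infinity>" "B \<subseteq> C"
  shows "measure (uniform_measure M A) B \<le> measure M C / measure M A"
proof -
  have "measure (uniform_measure M A) B = measure M (A \<inter> B) / measure M A"
    using assms(2,4,5) by (simp add: measure_uniform_measure)
  also have "\<dots> \<le> measure M C / measure M A"
    using assms(1,2,3,6) by (intro divide_right_mono measure_mono_fmeasurable) auto
  finally show ?thesis .
qed

theorem theorem5p1:
  fixes \<X> :: "(real ^ 'd) set"
    and f :: "real ^ 'd \<Rightarrow> real"
    and \<kappa> :: real
    and t :: nat
    and candidates Xs :: "(real ^ 'd) list"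
  assumes "compact \<X>" and "convex \<X>" and "interior \<X> \<noteq> {}"
    and "\<kappa> > 0"
    and "\<kappa>-lipschitz_on \<X> f"
    and "t \<ge> 1"
    and "set candidates \<subseteq> \<X>"
    and "Xs = lipo f \<kappa> candidates"
    and "length Xs = t"
  shows "\<P>(x in uniform_measure lborel \<X>. lipo_rejects f \<kappa> Xs x)
    \<le> (real t * pi powr (real CARD('d) / 2) * image_range f \<X> ^ CARD('d))
       / (\<kappa> ^ CARD('d) * Gamma (real CARD('d) / 2 + 1) * measure lborel \<X>)"
proof -
  define \<Delta> where "\<Delta> = image_range f \<X>"
  define r where "r = \<Delta> / \<kappa>"
  define U where "U = (\<Union>z\<in>set Xs. ball z r)"
  have ne: "Xs \<noteq> []"
    using assms(6,9) by auto
  have sub: "set Xs \<subseteq> \<X>"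
    using set_lipo_subset assms(7,8) by blast
  have cont: "continuous_on \<X> f"
    using assms(5) by (rule lipschitz_on_continuous_on)
  have range: "f w - f z \<le> \<Delta>" if "z \<in> set Xs" "w \<in> set Xs" for z w
    unfolding \<Delta>_def using diff_le_image_range[OF assms(1) cont] that sub by blast
  have "\<Delta> \<ge> 0"
    using range[of "hd Xs" "hd Xs"] ne by simp
  then have r: "r \<ge> 0"
    using assms(4) by (simp add: r_def)

  have U: "U \<in> fmeasurable lborel"
    unfolding U_def by (intro fmeasurable.finite_UN) (auto intro!: fmeasurableI emeasure_bounded_finite)
  have rej: "{x. lipo_rejects f \<kappa> Xs x} \<subseteq> U"
    unfolding U_def r_def using lipo_rejects_subset_balls[OF assms(4) ne range] .
  have "open {x. lipo_rejects f \<kappa> Xs x}"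
    unfolding lipo_rejects_iff[OF ne] Collect_bex_eq
    by (intro open_UN ballI open_Collect_less continuous_intros)
  then have rej_meas: "{x. lipo_rejects f \<kappa> Xs x} \<in> sets lborel"
    by simp

  have "emeasure lborel \<X> \<noteq> 0"
  proof
    assume "emeasure lborel \<X> = 0"
    then have "\<X> \<in> null_sets lborel"
      using assms(1) by (auto simp: null_sets_def borel_compact)
    then have "negligible \<X>"
      by (simp add: negligible_iff_null_sets null_sets_completionI)
    then show False
      using assms(3) negligible_subset[OF _ interior_subset] open_not_negligible open_interior
      by blast
  qed
  moreover have "emeasure lborel \<X> \<noteq> \<infinity>"
    using emeasure_compact_finite[OF assms(1)] by simp
  ultimately have "\<P>(x in uniform_measure lborel \<X>. lipo_rejects f \<kappa> Xs x)
      \<le> measure lborel U / measure lborel \<X>"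
    using measure_uniform_measure_le[OF _ rej_meas U _ _ rej] assms(1)
    by (simp add: borel_compact)
  also have "\<dots> \<le> (real t * (unit_ball_vol CARD('d) * r ^ CARD('d))) / measure lborel \<X>"
  proof (intro divide_right_mono)
    have "measure lborel U \<le> real (card (set Xs)) * (unit_ball_vol CARD('d) * r ^ CARD('d))"
      using measure_UN_balls_le[of "set Xs" r] r by (simp add: U_def)
    \<comment> \<open>A candidate drawn twice may occur twice among the potential maximizers, so the number
      of distinct ball centres is only bounded by the length of the list.\<close>
    also have "\<dots> \<le> real t * (unit_ball_vol CARD('d) * r ^ CARD('d))"
      using card_length[of Xs] assms(9) r by (intro mult_right_mono) auto
    finally show "measure lborel U \<le> real t * (unit_ball_vol CARD('d) * r ^ CARD('d))" .
  qed simp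
  also have "\<dots> = (real t * pi powr (real CARD('d) / 2) * \<Delta> ^ CARD('d))
       / (\<kappa> ^ CARD('d) * Gamma (real CARD('d) / 2 + 1) * measure lborel \<X>)"
    by (simp add: r_def unit_ball_vol_def power_divide mult_ac)
  finally show ?thesis
    unfolding \<Delta>_def .
qed

end
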